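(* Let $p\ge1$ be an integer, let $f,g \in L^{1}\cap L^{2}(\mathbb{R}^2,\mathbb{H}(\mu))$, and suppose $\mathcal{L}^{\mu,\mu}[f]\in L^{p}(\mathbb{R}^2,\mathbb{H}(\mu))$ and $\mathcal{L}^{\mu,\mu}[g]\in L^{1}(\mathbb{R}^2,\mathbb{H}(\mu))$, where $\mathcal L^{\mu,\mu}=\mathcal L^{\mu,\mu}_{A_1,A_2}$. Put $\breve{A}_{i}=\begin{pmatrix}2a_{i}&b_{i}\\ \frac{1}{b_{i}}+2c_{i}&d_{i}\end{pmatrix}$ for $i=1,2$. Then $$\mathcal{L}^{\mu,\mu}\big[e^{\mu\frac{a_{1}}{2b_{1}}x^{2}}e^{\mu\frac{a_{2}}{2b_{2}}y^{2}}f(x,y)g(x,y)\big](u,v)=\big(\mathcal{L}^{\mu,\mu}[f]\circledast_{A_{1}^{-1},A_{2}^{-1}}\mathcal{L}^{\mu,\mu}[g]\big)(u,v)$$ and $$\mathcal{L}_{\breve{A}_{1},\breve{A}_{2}}^{\mu,\mu}[fg](u,v)=\big(\mathcal{L}^{\mu,\mu}[f]\circledast_{A_{1}^{-1},A_{2}^{-1}}\mathcal{L}^{\mu,\mu}[g]\big)(u,v).$$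
   Context: $\mathbb H$ is the quaternion algebra with real basis $1,\mu,\nu,\eta$, where $\mu^2=\nu^2=\eta^2=\mu\nu\eta=-1$, $\mu\nu=-\nu\mu=\eta$. $\mathbb H(\mu)=\{q_r+\mu q_\mu:q_r,q_\mu\in\mathbb R\}$. $L^p(\mathbb R^2,\mathbb H(\mu))$ is the space of $f:\mathbb R^2\to\mathbb H(\mu)$ with $\|f\|_p=(\int_{\mathbb R^2}|f|^p\,dx\,dy)^{1/p}<\infty$. $A_i=\begin{pmatrix}a_i&b_i\\c_i&d_i\end{pmatrix}$, $i=1,2$, are real matrices with $a_id_i-b_ic_i=1$ and $b_i\neq0$; $A_i^{-1}=\begin{pmatrix}d_i&-b_i\\-c_i&a_i\end{pmatrix}$. For a real matrix $A=\begin{pmatrix}a&b\\c&d\end{pmatrix}$ of determinant $1$ with $b\ne0$, $$K_A^{\mu}(x,u)=\frac{1}{\sqrt{2\pi b\mu}}\,e^{\mu(\frac{a}{2b}x^2-\frac1b xu+\frac{d}{2b}u^2)},\qquad W_A^\mu(t,\tau)=\frac{1}{\sqrt{2\pi b\mu}}\,e^{\mu\tau(\tau-t)\frac ab},$$ with the principal square root in $\mathbb H(\mu)\cong\mathbb C$. For such matrices $B_1,B_2$ and integrable $f$, $\mathcal L^{\mu,\mu}_{B_1,B_2}[f](u,v)=\int_{\mathbb R^2}K^{\mu}_{B_1}(x,u)f(x,y)K^{\mu}_{B_2}(y,v)\,dx\,dy$, and $$(F\circledast_{B_1,B_2} G)(u,v)=\int_{\mathbb R^2}W_{B_1}^{\mu}(u,\tau_1)F(\tau_1,\tau_2)G(u-\tau_1,v-\tau_2)W_{B_2}^{\mu}(v,\tau_2)\,d\tau_1d\tau_2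 .$$ *)

theory Defs
  imports "HOL-Analysis.Analysis"
begin

datatype quat = Quat (q_re: real) (q_mu: real) (q_nu: real) (q_eta: real)

lemma quat_eq_iff:
  "p = q \<longleftrightarrow> q_re p = q_re q \<and> q_mu p = q_mu q \<and> q_nu p = q_nu q \<and> q_eta p = q_eta q"
  by (cases p; cases q) simp

instantiation quat :: division_ring
begin

definition "0 = Quat 0 0 0 0"
definition "1 = Quat 1 0 0 0"
definition "p + q = Quat (q_re p + q_re q) (q_mu p + q_mu q) (q_nu p + q_nu q) (q_eta p + q_eta q)"
definition "- q = Quat (- q_re q) (- q_mu q) (- q_nu q) (- q_eta q)"
definition "p - q = Quat (q_re p - q_re q) (q_mu p - q_mu q) (q_nu p - q_nu q) (q_eta p - q_eta q)"
definition "p * q = Quat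
  (q_re p * q_re q - q_mu p * q_mu q - q_nu p * q_nu q - q_eta p * q_eta q)
  (q_re p * q_mu q + q_mu p * q_re q + q_nu p * q_eta q - q_eta p * q_nu q)
  (q_re p * q_nu q - q_mu p * q_eta q + q_nu p * q_re q + q_eta p * q_mu q)
  (q_re p * q_eta q + q_mu p * q_nu q - q_nu p * q_mu q + q_eta p * q_re q)"
definition "inverse q =
  (let n = (q_re q)\<^sup>2 + (q_mu q)\<^sup>2 + (q_nu q)\<^sup>2 + (q_eta q)\<^sup>2
   in Quat (q_re q / n) (- q_mu q / n) (- q_nu q / n) (- q_eta q / n))"
definition "p div q = p * inverse q" for p q :: quat

lemmas quat_ring_defs =
  zero_quat_def one_quat_def plus_quat_def uminus_quat_def minus_quat_def times_quat_def

lemma quat_sum_squares_eq_0: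
  "(q_re q)\<^sup>2 + (q_mu q)\<^sup>2 + (q_nu q)\<^sup>2 + (q_eta q)\<^sup>2 = 0 \<longleftrightarrow> q = 0"
  by (auto simp: quat_eq_iff zero_quat_def add_nonneg_eq_0_iff)

lemma quat_inverse_mult:
  fixes q :: quat
  assumes "q \<noteq> 0"
  shows "inverse q * q = 1" "q * inverse q = 1"
proof -
  define n where "n = (q_re q)\<^sup>2 + (q_mu q)\<^sup>2 + (q_nu q)\<^sup>2 + (q_eta q)\<^sup>2"
  have n: "n \<noteq> 0"
    using assms quat_sum_squares_eq_0 unfolding n_def by blast
  have inv: "inverse q = Quat (q_re q / n) (- q_mu q / n) (- q_nu q / n) (- q_eta q / n)"
    by (simp add: inverse_quat_def n_def Let_def)
  have one: "q_re q * q_re q / n + q_mu q * q_mu q / n + q_nu q * q_nu q / n + q_eta q * q_eta q / n = 1"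
    using n by (simp add: n_def power2_eq_square flip: add_divide_distrib)
  show "inverse q * q = 1" "q * inverse q = 1"
    using one by (simp_all add: inv quat_eq_iff times_quat_def one_quat_def mult.commute)
qed

instance
  by standard
    (simp_all add: quat_inverse_mult divide_quat_def,
     simp_all add: quat_eq_iff quat_ring_defs inverse_quat_def algebra_simps)

end

instantiation quat :: real_algebra_1
begin

definition "r *\<^sub>R q = Quat (r * q_re q) (r * q_mu q) (r * q_nu q) (r * q_eta q)"

instance
  by standard (simp_all add: quat_eq_iff quat_ring_defs scaleR_quat_def algebra_simps)

end

instantiation quat :: real_inner
begin

definition "inner p q = q_re p * q_re q + q_mu p * q_mu q + q_nu p * q_nu q + q_eta p * q_eta q"
definition "norm q = sqrt (inner q q)" for q :: quat
definition "sgn q = q /\<^sub>R norm q" for q :: quat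
definition "dist p q = norm (p - q)" for p q :: quat
definition "(uniformity :: (quat \<times> quat) filter) =
  (INF e\<in>{0 <..}. principal {(x, y). dist x y < e})"
definition "open (U :: quat set) \<longleftrightarrow>
  (\<forall>x\<in>U. eventually (\<lambda>(x', y). x' = x \<longrightarrow> y \<in> U) uniformity)"

instance
proof
  fix x y z :: quat and r :: real
  show "inner x y = inner y x"
    by (simp add: inner_quat_def mult.commute)
  show "inner (x + y) z = inner x z + inner y z"
    by (simp add: inner_quat_def plus_quat_def algebra_simps)
  show "inner (r *\<^sub>R x) y = r * inner x y"
    by (simp add: inner_quat_def scaleR_quat_def algebra_simps)
  show "0 \<le> inner x x"
    by (simp add: inner_quat_def)
  show "inner x x = 0 \<longleftrightarrow> x = 0"
    using quat_sum_squares_eq_0[of x] by (simp add: inner_quat_def power2_eq_square)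
qed (rule norm_quat_def sgn_quat_def dist_quat_def uniformity_quat_def open_quat_def)+

end

instance quat :: real_normed_div_algebra
proof
  fix x y :: quat
  have "inner (x * y) (x * y) = inner x x * inner y y"
    by (simp add: inner_quat_def times_quat_def algebra_simps)
  then show "norm (x * y) = norm x * norm y"
    by (simp add: norm_quat_def real_sqrt_mult)
qed

definition \<mu> :: quat where "\<mu> = Quat 0 1 0 0"
definition \<nu> :: quat where "\<nu> = Quat 0 0 1 0"
definition \<eta> :: quat where "\<eta> = Quat 0 0 0 1"

lemma quat_relations:
  "\<mu> * \<mu> = -1" "\<nu> * \<nu> = -1" "\<eta> * \<eta> = -1" "\<mu> * \<nu> * \<eta> = -1" "\<mu> * \<nu> = \<eta>" "\<nu> * \<mu> = - \<eta>"
  by (simp_all add: quat_eq_iff quat_ring_defs \<mu>_def \<nu>_def \<eta>_def)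

instantiation quat :: euclidean_space
begin

definition "Basis = {1, \<mu>, \<nu>, \<eta>}"

instance
proof
  fix u v x :: quat
  show "(Basis :: quat set) \<noteq> {}" "finite (Basis :: quat set)"
    by (simp_all add: Basis_quat_def)
  show "inner u v = (if u = v then 1 else 0)" if "u \<in> Basis" "v \<in> Basis"
    using that unfolding Basis_quat_def insert_iff empty_iff
    by (elim disjE) (simp_all add: inner_quat_def one_quat_def \<mu>_def \<nu>_def \<eta>_def)
  show "(\<forall>u\<in>Basis. inner x u = 0) \<longleftrightarrow> x = 0"
    by (simp add: Basis_quat_def inner_quat_def one_quat_def zero_quat_def \<mu>_def \<nu>_def \<eta>_def
        quat_eq_iff[of x])
qed

end

definition H_mu :: "quat set" where
  "H_mu = {of_real r + \<mu> * of_real s | r s. True}"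

text \<open>The isomorphism from the complex numbers onto \<^const>\<open>H_mu\<close> sending the imaginary unit to
  \<^const>\<open>\<mu>\<close>; it transports the principal square root.\<close>

definition of_complex_mu :: "complex \<Rightarrow> quat" where
  "of_complex_mu z = of_real (Re z) + \<mu> * of_real (Im z)"

definition sqrt_mu :: "quat \<Rightarrow> quat" where
  "sqrt_mu q = of_complex_mu (csqrt (Complex (q_re q) (q_mu q)))"

lemma of_complex_mu_eq: "of_complex_mu z = Quat (Re z) (Im z) 0 0"
  by (simp add: of_complex_mu_def quat_eq_iff of_real_def scaleR_quat_def quat_ring_defs \<mu>_def)

lemma of_complex_mu_hom:
  "of_complex_mu 1 = 1"
  "of_complex_mu \<i> = \<mu>"
  "of_complex_mu (w + z) = of_complex_mu w + of_complex_mu z"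
  "of_complex_mu (w * z) = of_complex_mu w * of_complex_mu z"
  by (simp_all add: of_complex_mu_eq one_quat_def \<mu>_def plus_quat_def times_quat_def)

lemma range_of_complex_mu: "range of_complex_mu = H_mu"
proof
  show "range of_complex_mu \<subseteq> H_mu"
    by (auto simp: of_complex_mu_def H_mu_def)
  have "of_real r + \<mu> * of_real s = of_complex_mu (Complex r s)" for r s
    by (simp add: of_complex_mu_def)
  then show "H_mu \<subseteq> range of_complex_mu"
    by (auto simp: H_mu_def)
qed

lemma sqrt_mu_of_complex_mu: "sqrt_mu (of_complex_mu z) = of_complex_mu (csqrt z)"
  by (simp add: sqrt_mu_def of_complex_mu_eq)

definition Lp_mu :: "nat \<Rightarrow> (real \<times> real \<Rightarrow> quat) set" where
  "Lp_mu p = {f. range f \<subseteq> H_mu \<and> f \<in> borel_measurable lebesgue \<and>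
                 integrable lebesgue (\<lambda>z. norm (f z) ^ p)}"

definition mat2 :: "real \<Rightarrow> real \<Rightarrow> real \<Rightarrow> real \<Rightarrow> real^2^2" where
  "mat2 a b c d = vector [vector [a, b], vector [c, d]]"

lemma matrix_inv_det_1:
  fixes A :: "real^2^2"
  assumes "det A = 1"
  shows "matrix_inv A = mat2 (A$2$2) (- A$1$2) (- A$2$1) (A$1$1)"
proof -
  have d: "A$1$1 * A$2$2 - A$1$2 * A$2$1 = 1"
    using assms by (simp add: det_2)
  let ?B = "mat2 (A$2$2) (- A$1$2) (- A$2$1) (A$1$1)"
  have 1: "A ** ?B = mat 1" "?B ** A = mat 1"
    using d by (simp_all add: vec_eq_iff forall_2 matrix_matrix_mult_def sum_2 mat_def mat2_def
        algebra_simps)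
  have inv: "matrix_inv A ** A = mat 1"
    using someI[of "\<lambda>B. A ** B = mat 1 \<and> B ** A = mat 1" ?B] 1
    unfolding matrix_inv_def by blast
  have "matrix_inv A = matrix_inv A ** (A ** ?B)"
    by (simp only: 1 matrix_mul_rid)
  also have "\<dots> = ?B"
    by (simp only: matrix_mul_assoc inv matrix_mul_lid)
  finally show ?thesis .
qed

definition K_mu :: "real^2^2 \<Rightarrow> real \<Rightarrow> real \<Rightarrow> quat" where
  "K_mu A x u =
    1 / sqrt_mu (of_real (2 * pi * A$1$2) * \<mu>) *
    exp (\<mu> * of_real (A$1$1 / (2 * A$1$2) * x\<^sup>2 - 1 / A$1$2 * x * u + A$2$2 / (2 * A$1$2) * u\<^sup>2))"

definition W_mu :: "real^2^2 \<Rightarrow> real \<Rightarrow> real \<Rightarrow> quat" where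
  "W_mu A t \<tau> =
    1 / sqrt_mu (of_real (2 * pi * A$1$2) * \<mu>) *
    exp (\<mu> * of_real (\<tau> * (\<tau> - t) * (A$1$1 / A$1$2)))"

definition lct_mu ::
  "real^2^2 \<Rightarrow> real^2^2 \<Rightarrow> (real \<times> real \<Rightarrow> quat) \<Rightarrow> real \<times> real \<Rightarrow> quat" where
  "lct_mu B1 B2 f = (\<lambda>(u, v). \<integral>(x, y). K_mu B1 x u * f (x, y) * K_mu B2 y v \<partial>lebesgue)"

definition conv_mu ::
  "real^2^2 \<Rightarrow> real^2^2 \<Rightarrow> (real \<times> real \<Rightarrow> quat) \<Rightarrow> (real \<times> real \<Rightarrow> quat) \<Rightarrow> real \<times> real \<Rightarrow> quat" where
  "conv_mu B1 B2 F G = (\<lambda>(u, v). \<integral>(\<tau>1, \<tau>2).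
     W_mu B1 u \<tau>1 * F (\<tau>1, \<tau>2) * G (u - \<tau>1, v - \<tau>2) * W_mu B2 v \<tau>2 \<partial>lebesgue)"

definition breve :: "real^2^2 \<Rightarrow> real^2^2" where
  "breve A = mat2 (2 * A$1$1) (A$1$2) (1 / A$1$2 + 2 * A$2$1) (A$2$2)"

end

theory Submission
  imports Defs "HOL-Probability.Characteristic_Functions"
begin

text \<open>Up to the constants and the chirp factors, the linear canonical transform is a Fourier
  transform \<open>\<F>\<close> with kernel \<open>exp (- \<mu> (x s / b1 + y t / b2))\<close>. The weight \<^const>\<open>W_mu\<close> of the inverse
  matrices is exactly what makes the chirps of the two transforms collapse to a single chirp
  in \<open>(u, v)\<close>, so the claim becomes the convolution theorem
  \<open>\<integral> (\<F> \<phi>)(t) (\<F> \<gamma>)(s - t) dt = (2 \<pi>)\<^sup>2 \<bar>b1 b2\<bar> \<F> (\<phi> \<gamma>) s\<close>.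
  By Fubini the left-hand side is the integral of \<open>\<phi>\<close> against the transform of
  \<open>t \<mapsto> (\<F> \<gamma>)(s - t)\<close>, which is evaluated by almost everywhere Fourier inversion for integrable
  \<open>\<gamma>\<close> with integrable \<open>\<F> \<gamma>\<close>. Inversion is obtained by testing \<open>\<gamma>\<close> against Gaussians, averaging
  over a box and letting the width tend to 0. Since every function takes values in the commutative
  field \<^const>\<open>H_mu\<close>, all of this takes place in the complex numbers.\<close>

section \<open>Functions determined by their integrals over boxes\<close>

text \<open>Boxes form an intersection-stable generator of the Borel sets, so a Dynkin class
  argument extends the vanishing of the integrals to all Borel sets. Since \<open>w\<close> is only
  locally integrable, the argument runs on its restriction \<open>v\<close> to one box; countably
  many boxes then cover the space.\<close>

lemma AE_eq_0_if_box_integrals_eq_0: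
  fixes w :: "'a::euclidean_space \<Rightarrow> 'b::{second_countable_topology, banach}"
  assumes int: "\<And>a b. set_integrable lborel (box a b) w"
    and zero: "\<And>a b. (LINT x:box a b|lborel. w x) = 0"
  shows "AE x in lborel. w x = 0"
proof -
  have on_box: "AE x in lborel. indicator (box l r) x *\<^sub>R w x = 0" for l r
  proof -
    define v where "v = (\<lambda>x. indicator (box l r) x *\<^sub>R w x)"
    have v: "integrable lborel v"
      using int[of l r] by (simp add: v_def set_integrable_def)
    have vA: "set_integrable lborel A v" if "A \<in> sets borel" for A
      unfolding set_integrable_def using that v by (intro integrable_mult_indicator) auto
    have v_box: "(LINT x:box a b|lborel. v x) = 0" for a b
    proof -
      have "(LINT x:box a b|lborel. v x) = (LINT x:box a b \<inter> box l r|lborel. w x)"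
        by (simp add: set_lebesgue_integral_def v_def indicator_inter_arith)
      also have "\<dots> = 0"
        by (simp only: box_Int_box zero)
      finally show ?thesis .
    qed
    \<comment> \<open>Needed for complements in the Dynkin class. The whole space is reached as an
      increasing union of boxes.\<close>
    have v_UNIV: "integral\<^sup>L lborel v = 0"
    proof -
      let ?D = "\<lambda>n::nat. box (- (real n *\<^sub>R One)) (real n *\<^sub>R One) :: 'a set"
      have inc: "incseq ?D"
      proof (rule incseq_SucI, rule subsetI)
        fix n x assume "x \<in> ?D n"
        then have "- real n < x \<bullet> i \<and> x \<bullet> i < real n" if "i \<in> Basis" for i
          using that by (auto simp: mem_box)
        then show "x \<in> ?D (Suc n)"
          by (force simp: mem_box)
      qed
      have U: "(\<Union>n. ?D n) = UNIV"
        using UN_box_eq_UNIV by simp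
      have "(\<lambda>n. LINT x:?D n|lborel. v x) \<longlonglongrightarrow> (LINT x:(\<Union>n. ?D n)|lborel. v x)"
        by (rule set_integral_cont_up) (use inc U v vA in auto)
      then show ?thesis
        unfolding U v_box by (simp add: set_lebesgue_integral_def LIMSEQ_const_iff)
    qed
    have "(LINT x:A|lborel. v x) = 0" if A: "A \<in> sets borel" for A
    proof -
      have "sigma_sets UNIV (range (\<lambda>(a, b). box a b)) = sets (borel :: 'a measure)"
        by (simp add: borel_eq_box)
      then have *: "A \<in> sigma_sets UNIV (range (\<lambda>(a, b). box a b))"
        using A by simp
      have "Int_stable (range (\<lambda>(a, b). box a b) :: 'a set set)"
        by (auto simp: Int_stable_def box_Int_box)
      moreover have "range (\<lambda>(a, b). box a b) \<subseteq> Pow (UNIV :: 'a set)"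
        by simp
      ultimately show ?thesis
        using *
      proof (induction rule: sigma_sets_induct_disjoint)
        case (basic A)
        then show ?case using v_box by auto
      next
        case empty
        then show ?case by (simp add: set_lebesgue_integral_def)
      next
        case (compl A)
        then have A: "A \<in> sets borel" by (simp add: borel_eq_box)
        have "(LINT x:UNIV|lborel. v x) = (LINT x:A|lborel. v x) + (LINT x:UNIV - A|lborel. v x)"
          using A by (subst set_integral_Un[symmetric]) (auto intro!: vA simp: Un_absorb1)
        then show ?case
          using compl v_UNIV by (simp add: set_lebesgue_integral_def)
      next
        case (union A)
        then have A: "A i \<in> sets borel" for i by (auto simp: borel_eq_box)
        have "(LINT x:(\<Union>i. A i)|lborel. v x) = (\<Sum>i. (LINT x:A i|lborel. v x))"
          using A union(1) by (intro lebesgue_integral_countable_add)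
            (auto intro!: vA simp: disjoint_family_on_def)
        then show ?case using union by simp
      qed
    qed
    then have "AE x in lborel. v x = 0"
      using v by (intro sigma_finite_measure.density_unique_banach[OF sigma_finite_lborel])
        (auto simp: set_lebesgue_integral_def)
    then show ?thesis by (simp add: v_def)
  qed
  have "AE x in lborel. \<forall>n::nat. indicator (box (- (real n *\<^sub>R One)) (real n *\<^sub>R One)) x *\<^sub>R w x = 0"
    using on_box by (subst AE_all_countable) blast
  then show ?thesis
  proof eventually_elim
    case (elim x)
    obtain n where "x \<in> box (- (real n *\<^sub>R One)) (real n *\<^sub>R One)"
      using UN_box_eq_UNIV by blast
    then show ?case using elim by (auto simp: indicator_def)
  qed
qed

section \<open>Gaussian Fourier integrals on the line, and integrals of products\<close>

lemma borel_measurable_cis [measurable]: "cis \<in> borel_measurable borel"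
  by (intro borel_measurable_continuous_onI continuous_intros)

lemma std_normal_density_fourier:
  "(\<integral>s. cis (t * s) * std_normal_density s \<partial>lborel) = complex_of_real (exp (- (t\<^sup>2) / 2))"
proof -
  have "char std_normal_distribution t = (\<integral>s. std_normal_density s *\<^sub>R cis (t * s) \<partial>lborel)"
    unfolding char_def by (subst integral_density) (auto simp: cis_conv_exp)
  then show ?thesis
    by (simp add: char_std_normal_distribution scaleR_conv_of_real mult.commute)
qed

text \<open>The substitution \<open>s = b / d * z\<close> reduces this to the standard normal
  density. The value is again written as a density, now in \<open>t / d\<close>, because it will act
  as an approximate identity when \<open>d\<close> tends to 0.\<close>

lemma gaussian_fourier:
  fixes b d t :: real
  assumes "b \<noteq> 0" "d > 0"
  shows "(\<integral>s. cis (t * s / b) * complex_of_real (exp (- ((d * s / b)\<^sup>2) / 2)) \<partial>lborel)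
    = 2 * pi * \<bar>b\<bar> / d * std_normal_density (t / d)"
proof -
  have "(\<integral>s. cis (t * s / b) * complex_of_real (exp (- ((d * s / b)\<^sup>2) / 2)) \<partial>lborel) =
    \<bar>b / d\<bar> *\<^sub>R (\<integral>z. cis (t / d * z) * complex_of_real (exp (- (z\<^sup>2) / 2)) \<partial>lborel)"
    using assms by (subst lborel_integral_real_affine[where c="b / d" and t=0]) (auto simp: field_simps)
  also have "(\<integral>z. cis (t / d * z) * complex_of_real (exp (- (z\<^sup>2) / 2)) \<partial>lborel) =
    (\<integral>z. sqrt (2 * pi) * (cis (t / d * z) * std_normal_density z) \<partial>lborel)"
    by (intro Bochner_Integration.integral_cong) (auto simp: std_normal_density_def)
  also have "\<dots> = sqrt (2 * pi) * exp (- ((t / d)\<^sup>2) / 2)"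
    by (subst integral_mult_right_zero) (simp only: std_normal_density_fourier of_real_mult)
  also have "sqrt (2 * pi) * exp (- ((t / d)\<^sup>2) / 2) = 2 * pi * std_normal_density (t / d)"
    by (simp add: std_normal_density_def field_simps)
  finally show ?thesis
    using assms by (simp add: scaleR_conv_of_real)
qed

lemma gaussian_fourier_integrable:
  fixes b d t :: real
  assumes "b \<noteq> 0" "d > 0"
  shows "integrable lborel (\<lambda>s. cis (t * s / b) * complex_of_real (exp (- ((d * s / b)\<^sup>2) / 2)))"
proof -
  have "integrable lborel (\<lambda>z. sqrt (2 * pi) * std_normal_density z)"
    by (intro integrable_mult_right integrable_normal_density) simp
  then have "integrable lborel (\<lambda>z::real. exp (- (z\<^sup>2) / 2))"
    by (simp add: std_normal_density_def)
  then have "integrable lborel (\<lambda>s. exp (- ((0 + d / b * s)\<^sup>2) / 2))"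
    using assms by (subst lborel_integrable_real_affine_iff) auto
  then show ?thesis
    by (rule Bochner_Integration.integrable_bound) (auto simp: norm_mult norm_exp)
qed

text \<open>Splits planar Gaussian integrals into one-dimensional ones and supplies the integrable
  majorants for the later exchanges of integrals.\<close>

lemma (in pair_sigma_finite)
  fixes f :: "'a \<Rightarrow> 'c::{real_normed_field, banach, second_countable_topology}"
  assumes f: "integrable M1 f" and g: "integrable M2 g"
  shows integrable_pair_mult: "integrable (M1 \<Otimes>\<^sub>M M2) (\<lambda>z. f (fst z) * g (snd z))"
    and integral_pair_mult:
      "(\<integral>z. f (fst z) * g (snd z) \<partial>(M1 \<Otimes>\<^sub>M M2)) = integral\<^sup>L M1 f * integral\<^sup>L M2 g"
proof -
  have [measurable]: "f \<in> borel_measurable M1" "g \<in> borel_measurable M2"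
    using f g by auto
  show int: "integrable (M1 \<Otimes>\<^sub>M M2) (\<lambda>z. f (fst z) * g (snd z))"
    using f g by (intro Fubini_integrable) (auto simp: norm_mult)
  show "(\<integral>z. f (fst z) * g (snd z) \<partial>(M1 \<Otimes>\<^sub>M M2)) = integral\<^sup>L M1 f * integral\<^sup>L M2 g"
    using integral_fst'[OF int] by simp
qed

subsection \<open>The scaled Fourier transform on the plane\<close>

definition fourier_kernel :: "real \<Rightarrow> real \<Rightarrow> real \<times> real \<Rightarrow> real \<times> real \<Rightarrow> complex" where
  "fourier_kernel b c x s = cis (- (fst x * fst s / b + snd x * snd s / c))"

definition fourier :: "real \<Rightarrow> real \<Rightarrow> (real \<times> real \<Rightarrow> complex) \<Rightarrow> real \<times> real \<Rightarrow> complex" where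
  "fourier b c f s = (\<integral>x. f x * fourier_kernel b c x s \<partial>lborel)"

text \<open>Stated for arbitrary measurable arguments, so that both may vary jointly inside
  parametrised integrals.\<close>

lemma borel_measurable_fourier_kernel [measurable (raw)]:
  assumes [measurable]: "X \<in> borel_measurable M" "S \<in> borel_measurable M"
  shows "(\<lambda>w. fourier_kernel b c (X w) (S w)) \<in> borel_measurable M"
proof -
  have [measurable]: "(\<lambda>w. fst (X w)) \<in> borel_measurable M" "(\<lambda>w. snd (X w)) \<in> borel_measurable M"
    "(\<lambda>w. fst (S w)) \<in> borel_measurable M" "(\<lambda>w. snd (S w)) \<in> borel_measurable M"
    using assms by (auto simp: borel_prod[symmetric])
  show ?thesis unfolding fourier_kernel_def by measurable
qed

lemma norm_fourier_kernel [simp]: "norm (fourier_kernel b c x s) = 1"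
  by (simp add: fourier_kernel_def)

lemma fourier_kernel_commute: "fourier_kernel b c x s = fourier_kernel b c s x"
  by (simp add: fourier_kernel_def mult.commute)

lemma fourier_kernel_minus: "fourier_kernel b c x (- s) = cnj (fourier_kernel b c x s)"
  by (simp add: fourier_kernel_def cis_cnj algebra_simps)

lemma fourier_kernel_diff:
  "fourier_kernel b c x (s - t) = fourier_kernel b c x s * cnj (fourier_kernel b c x t)"
  by (simp add: fourier_kernel_def cis_cnj cis_mult diff_divide_distrib algebra_simps)

lemma borel_measurable_fourier [measurable]:
  assumes [measurable]: "f \<in> borel_measurable borel"
  shows "fourier b c f \<in> borel_measurable borel"
  unfolding fourier_def by measurable

lemma norm_fourier_le:
  "norm (fourier b c f s) \<le> (\<integral>x. norm (f x) \<partial>lborel)"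
  unfolding fourier_def by (rule order_trans[OF integral_norm_bound]) (simp add: norm_mult)

text \<open>Fubini with majorant \<open>norm (f x) * norm (g s)\<close>, together with the symmetry
  of the kernel. It moves the transform from one factor to the other, both in the inversion and in
  the convolution theorem.\<close>

lemma fourier_pairing:
  assumes f: "integrable lborel f" and g: "integrable lborel g"
  shows "(\<integral>s. fourier b c f s * g s \<partial>lborel) = (\<integral>x. f x * fourier b c g x \<partial>lborel)"
proof -
  have [measurable]: "f \<in> borel_measurable borel" "g \<in> borel_measurable borel"
    using f g by auto
  have "integrable (lborel \<Otimes>\<^sub>M lborel)
      (\<lambda>z. f (fst z) * g (snd z) * fourier_kernel b c (fst z) (snd z))"
    by (rule Bochner_Integration.integrable_bound[OF lborel_pair.integrable_pair_mult[OF f g]])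
       (auto simp: norm_mult)
  then have "(\<integral>s. (\<integral>x. f x * g s * fourier_kernel b c x s \<partial>lborel) \<partial>lborel) =
    (\<integral>x. (\<integral>s. f x * g s * fourier_kernel b c x s \<partial>lborel) \<partial>lborel)"
    by (intro lborel_pair.Fubini_integral) (simp add: case_prod_unfold)
  moreover have "(\<integral>x. f x * g s * fourier_kernel b c x s \<partial>lborel) = fourier b c f s * g s" for s
    unfolding fourier_def by (subst integral_mult_left_zero[symmetric]) (simp add: mult_ac)
  moreover have "(\<integral>s. f x * g s * fourier_kernel b c x s \<partial>lborel) = f x * fourier b c g x" for x
    unfolding fourier_def
    by (subst integral_mult_right_zero[symmetric]) (simp add: mult_ac fourier_kernel_commute)
  ultimately show ?thesis by simp
qed

section \<open>The planar Gaussian and damped waves\<close>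

definition gauss2 :: "real \<times> real \<Rightarrow> real" where
  "gauss2 z = std_normal_density (fst z) * std_normal_density (snd z)"

lemma borel_measurable_gauss2 [measurable]: "gauss2 \<in> borel_measurable borel"
proof -
  have "gauss2 \<in> borel_measurable (borel \<Otimes>\<^sub>M borel)"
    unfolding gauss2_def by measurable
  then show ?thesis by (simp add: borel_prod)
qed

lemma gauss2_nonneg: "0 \<le> gauss2 z"
  by (simp add: gauss2_def)

lemma gauss2_le_1: "gauss2 z \<le> 1"
proof -
  have p: "1 \<le> 2 * pi" using pi_ge_two by simp
  have "1 / sqrt (2 * pi) * exp (- x\<^sup>2 / 2) \<le> 1 * 1" for x :: real
    using p by (intro mult_mono) simp_all
  from this[of "fst z"] this[of "snd z"] show ?thesis
    unfolding gauss2_def std_normal_density_def using p by (intro mult_le_one) auto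
qed

lemma integrable_gauss2: "integrable lborel gauss2"
  and integral_gauss2: "integral\<^sup>L lborel gauss2 = 1"
proof -
  have *: "integrable lborel std_normal_density" "integral\<^sup>L lborel std_normal_density = 1"
    by (auto intro!: integrable_normal_density integral_normal_density)
  show "integrable lborel gauss2" "integral\<^sup>L lborel gauss2 = 1"
    using lborel_pair.integrable_pair_mult[OF *(1) *(1)] lborel_pair.integral_pair_mult[OF *(1) *(1)] *(2)
    by (auto simp: gauss2_def[abs_def] lborel_prod)
qed

text \<open>The kernel of the inverse transform at \<open>x\<close>, made integrable in
  \<open>s\<close> by a Gaussian factor that tends to 1 as \<open>d\<close> tends to 0.\<close>

definition damped_wave :: "real \<Rightarrow> real \<Rightarrow> real \<Rightarrow> real \<times> real \<Rightarrow> real \<times> real \<Rightarrow> complex" where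
  "damped_wave b c d x s = cnj (fourier_kernel b c x s) *
     complex_of_real (exp (- ((d * fst s / b)\<^sup>2) / 2) * exp (- ((d * snd s / c)\<^sup>2) / 2))"

lemma
  fixes b c d :: real
  assumes nz: "b \<noteq> 0" "c \<noteq> 0" "d > 0"
  shows integrable_damped_wave: "integrable lborel (damped_wave b c d x)"
    and fourier_damped_wave: "fourier b c (damped_wave b c d x) y =
      complex_of_real ((2 * pi)\<^sup>2 * \<bar>b * c\<bar> / d\<^sup>2 * gauss2 ((x - y) /\<^sub>R d))"
proof -
  define G where "G b t s = cis (t * s / b) * complex_of_real (exp (- ((d * s / b)\<^sup>2) / 2))"
    for b t s :: real
  have int: "integrable lborel (G b t)" "integrable lborel (G c t)" for t
    unfolding G_def[abs_def] using gaussian_fourier_integrable nz by auto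
  \<comment> \<open>The kernel shifts the frequency from \<open>x\<close> to \<open>x - y\<close>,
    and the integrand separates into its two coordinates.\<close>
  have G_pair: "damped_wave b c d x s * fourier_kernel b c s y =
      G b (fst x - fst y) (fst s) * G c (snd x - snd y) (snd s)" for x y s
    by (simp add: damped_wave_def fourier_kernel_def G_def cis_cnj cis_mult mult_ac
        diff_divide_distrib algebra_simps add_divide_distrib)
  have *: "integrable lborel (\<lambda>s. damped_wave b c d x s * fourier_kernel b c s y)" for x y
    unfolding G_pair using lborel_pair.integrable_pair_mult[OF int] by (simp add: lborel_prod)
  \<comment> \<open>At \<open>y = 0\<close> the kernel is constantly 1.\<close>
  from *[of x 0] show "integrable lborel (damped_wave b c d x)"
    by (simp add: fourier_kernel_def)
  have "fourier b c (damped_wave b c d x) y =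
      integral\<^sup>L lborel (G b (fst x - fst y)) * integral\<^sup>L lborel (G c (snd x - snd y))"
    unfolding fourier_def G_pair using lborel_pair.integral_pair_mult[OF int] by (simp add: lborel_prod)
  also have "\<dots> = complex_of_real ((2 * pi)\<^sup>2 * \<bar>b * c\<bar> / d\<^sup>2 * gauss2 ((x - y) /\<^sub>R d))"
    unfolding G_def using nz by (subst (1 2) gaussian_fourier)
      (simp_all add: gauss2_def power2_eq_square abs_mult divide_inverse mult_ac)
  finally show "fourier b c (damped_wave b c d x) y =
      complex_of_real ((2 * pi)\<^sup>2 * \<bar>b * c\<bar> / d\<^sup>2 * gauss2 ((x - y) /\<^sub>R d))" .
qed

section \<open>Affine substitutions and Gaussian averages of indicators\<close>

lemma integral_lborel_affine:
  fixes f :: "'a::euclidean_space \<Rightarrow> 'b::{banach, second_countable_topology}"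
  assumes [measurable]: "f \<in> borel_measurable borel" and "c \<noteq> 0"
  shows "integral\<^sup>L lborel f = \<bar>c\<bar> ^ DIM('a) *\<^sub>R (\<integral>x. f (t + c *\<^sub>R x) \<partial>lborel)"
proof -
  have "integral\<^sup>L lborel f =
      integral\<^sup>L (density (distr lborel borel (\<lambda>x. t + c *\<^sub>R x)) (\<lambda>_. ennreal (\<bar>c\<bar> ^ DIM('a)))) f"
    using lborel_affine[OF \<open>c \<noteq> 0\<close>, of t] by (simp add: ennreal_power)
  then show ?thesis
    by (subst (asm) integral_density) (auto simp: integral_distr)
qed

lemma lborel_distr_reflect:
  fixes t :: "'a::euclidean_space"
  shows "distr lborel borel (\<lambda>x. t - x) = lborel"
  using lborel_affine[of "-1" t] by (simp add: density_1)

text \<open>The substitution \<open>x = y + d z\<close> has Jacobian \<open>d ^ 2\<close> in the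
  plane. It moves the scale from the Gaussian into the indicator, where the limit can be taken under
  a fixed integrable weight.\<close>

lemma integral_gauss2_rescaled:
  assumes "d > 0" and [measurable]: "A \<in> sets borel"
  shows "(\<integral>x. indicator A x * (gauss2 ((x - y) /\<^sub>R d) / d\<^sup>2) \<partial>lborel) =
    (\<integral>z. indicator A (y + d *\<^sub>R z) * gauss2 z \<partial>lborel)"
  using assms(1) by (subst integral_lborel_affine[where c=d and t=y]) (auto simp: power2_eq_square)

text \<open>Off the frontier the indicator is continuous at \<open>y\<close>, so the integrand
  converges pointwise, dominated by \<open>gauss2\<close>.\<close>

lemma gauss2_average_tendsto_indicator:
  assumes [measurable]: "A \<in> sets borel" and y: "y \<notin> frontier A"
  shows "(\<lambda>n. \<integral>z. indicator A (y + inverse (real (Suc n)) *\<^sub>R z) * gauss2 z \<partial>lborel)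
    \<longlonglongrightarrow> indicator A y"
proof -
  have "(\<lambda>n. \<integral>z. indicator A (y + inverse (real (Suc n)) *\<^sub>R z) * gauss2 z \<partial>lborel)
    \<longlonglongrightarrow> (\<integral>z. indicator A y * gauss2 z \<partial>lborel)"
  proof (rule integral_dominated_convergence[where w=gauss2])
    show "AE z in lborel. (\<lambda>n. indicator A (y + inverse (real (Suc n)) *\<^sub>R z) * gauss2 z)
        \<longlonglongrightarrow> indicator A y * gauss2 z"
    proof (intro always_eventually allI tendsto_mult_right)
      fix z
      have "(\<lambda>n. y + inverse (real (Suc n)) *\<^sub>R z) \<longlonglongrightarrow> y + 0 *\<^sub>R z"
        by (intro tendsto_intros LIMSEQ_inverse_real_of_nat)
      moreover have "isCont (indicator A :: _ \<Rightarrow> real) y"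
        using y by (simp add: isCont_indicator)
      ultimately show "(\<lambda>n. indicator A (y + inverse (real (Suc n)) *\<^sub>R z)) \<longlonglongrightarrow> (indicator A y :: real)"
        by (intro isCont_tendsto_compose[of y "indicator A"]) auto
    qed
  qed (auto simp: integrable_gauss2 gauss2_nonneg indicator_def)
  then show ?thesis by (simp add: integral_gauss2)
qed

lemma gauss2_average_bounds:
  assumes [measurable]: "A \<in> sets borel"
  shows "norm (\<integral>z. indicator A (y + d *\<^sub>R z) * gauss2 z \<partial>lborel) \<le> 1"
proof -
  have "norm (\<integral>z. indicator A (y + d *\<^sub>R z) * gauss2 z \<partial>lborel) \<le> integral\<^sup>L lborel gauss2"
    by (intro order_trans[OF integral_norm_bound] integral_mono')
       (auto simp: indicator_def gauss2_nonneg integrable_gauss2)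
  then show ?thesis by (simp add: integral_gauss2)
qed

section \<open>Fourier inversion and the convolution theorem\<close>

text \<open>Damping the outer transform turns it into a constant times a Gaussian average of
  \<open>g\<close>. Integrating over a box shifts that average onto the indicator of the box, whose
  limit is known almost everywhere, so no pointwise convergence of averages of \<open>g\<close> is
  required.\<close>

lemma fourier_inversion:
  fixes g :: "real \<times> real \<Rightarrow> complex"
  assumes g: "integrable lborel g" and Fg: "integrable lborel (fourier b c g)"
    and nz: "b \<noteq> 0" "c \<noteq> 0"
  shows "AE x in lborel. fourier b c (fourier b c g) (- x) = (2 * pi)\<^sup>2 * \<bar>b * c\<bar> * g x"
proof -
  define C :: real where "C = (2 * pi)\<^sup>2 * \<bar>b * c\<bar>"
  define \<delta> where "\<delta> n = inverse (real (Suc n))" for n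
  have \<delta>: "\<delta> n > 0" for n by (simp add: \<delta>_def)
  have \<delta>0: "\<delta> \<longlonglongrightarrow> 0" unfolding \<delta>_def by (rule LIMSEQ_inverse_real_of_nat)
  define H where "H x = fourier b c (fourier b c g) (- x)" for x
  define Hn where "Hn n x = (\<integral>s. fourier b c g s * damped_wave b c (\<delta> n) x s \<partial>lborel)" for n x
  define M where "M = (\<integral>s. norm (fourier b c g s) \<partial>lborel)"
  have [measurable]: "g \<in> borel_measurable borel"
    using g by auto
  have [measurable]: "H \<in> borel_measurable borel"
    unfolding H_def by measurable
  have dw_meas [measurable]: "damped_wave b c d x \<in> borel_measurable borel" for d x
    unfolding damped_wave_def[abs_def] fourier_kernel_def
    by (intro borel_measurable_continuous_onI continuous_intros) (use nz in auto)
  have dw_norm: "norm (damped_wave b c d x s) \<le> 1" for d x s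
    by (auto simp: damped_wave_def norm_mult intro!: mult_le_one)
  have H_bound: "norm (H x) \<le> M" for x
    unfolding H_def M_def by (rule norm_fourier_le)
  have Hn_bound: "norm (Hn n x) \<le> M" for n x
    unfolding Hn_def M_def
    using dw_norm Fg by (intro order_trans[OF integral_norm_bound] integral_mono')
      (auto simp: norm_mult mult_left_le)
  \<comment> \<open>The damped wave has modulus at most 1, so the integrable transform of
    \<open>g\<close> dominates.\<close>
  have Hn_tendsto: "(\<lambda>n. Hn n x) \<longlonglongrightarrow> H x" for x
    unfolding Hn_def H_def fourier_def[of b c "fourier b c g"]
  proof (rule integral_dominated_convergence[where w="\<lambda>s. norm (fourier b c g s)"])
    show "AE s in lborel. (\<lambda>n. fourier b c g s * damped_wave b c (\<delta> n) x s)
        \<longlonglongrightarrow> fourier b c g s * fourier_kernel b c s (- x)"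
    proof (intro always_eventually allI tendsto_mult_left)
      fix s
      have "(\<lambda>n. damped_wave b c (\<delta> n) x s) \<longlonglongrightarrow> cnj (fourier_kernel b c x s) *
          complex_of_real (exp (- ((0 * fst s / b)\<^sup>2) / 2) * exp (- ((0 * snd s / c)\<^sup>2) / 2))"
        unfolding damped_wave_def using nz by (intro tendsto_intros \<delta>0) auto
      then show "(\<lambda>n. damped_wave b c (\<delta> n) x s) \<longlonglongrightarrow> fourier_kernel b c s (- x)"
        by (simp add: fourier_kernel_minus fourier_kernel_commute[of b c s x])
    qed
  qed (use dw_norm Fg in \<open>auto simp: norm_mult mult_left_le\<close>)
  \<comment> \<open>The pairing moves the transform from \<open>g\<close> to the damped wave, where
    it is an explicit Gaussian around \<open>x\<close>.\<close>
  have Hn_eq: "Hn n x = C * (\<integral>y. g y * complex_of_real (gauss2 ((x - y) /\<^sub>R \<delta> n) / (\<delta> n)\<^sup>2) \<partial>lborel)" for n x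
  proof -
    have "Hn n x = (\<integral>y. g y * fourier b c (damped_wave b c (\<delta> n) x) y \<partial>lborel)"
      unfolding Hn_def using g integrable_damped_wave[OF nz \<delta>] by (rule fourier_pairing)
    also have "\<dots> = (\<integral>y. C * (g y * complex_of_real (gauss2 ((x - y) /\<^sub>R \<delta> n) / (\<delta> n)\<^sup>2)) \<partial>lborel)"
      by (simp only: fourier_damped_wave[OF nz \<delta>] C_def) (simp add: mult_ac)
    finally show ?thesis by simp
  qed
  have [measurable]: "Hn n \<in> borel_measurable borel" for n
    unfolding Hn_eq by measurable
  have box_eq: "(LINT x:box l r|lborel. H x) = C * (LINT x:box l r|lborel. g x)" for l r
  proof -
    let ?B = "box l r"
    define Q where "Q n y = (\<integral>z. indicator ?B (y + \<delta> n *\<^sub>R z) * gauss2 z \<partial>lborel)" for n y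
    have intB: "integrable lborel (\<lambda>x. indicator ?B x :: real)"
      by (intro integrable_real_indicator emeasure_lborel_box_finite) simp
    have "(\<lambda>n. LINT x:?B|lborel. Hn n x) \<longlonglongrightarrow> (LINT x:?B|lborel. H x)"
      unfolding set_lebesgue_integral_def
    proof (rule integral_dominated_convergence[where w="\<lambda>x. M * indicator ?B x"])
      show "AE x in lborel. (\<lambda>n. indicator ?B x *\<^sub>R Hn n x) \<longlonglongrightarrow> indicator ?B x *\<^sub>R H x"
        by (intro always_eventually allI tendsto_scaleR tendsto_const Hn_tendsto)
      show "integrable lborel (\<lambda>x. M * indicator ?B x)"
        using intB by simp
    qed (use Hn_bound in \<open>auto simp: indicator_def\<close>)
    \<comment> \<open>Integrating over \<open>x\<close> first replaces the Gaussian by the averaged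
      indicator \<open>Q n\<close>.\<close>
    moreover have "(LINT x:?B|lborel. Hn n x) = C * (\<integral>y. g y * Q n y \<partial>lborel)" for n
    proof -
      let ?k = "\<lambda>x y. g y * complex_of_real (indicator ?B x * (gauss2 ((x - y) /\<^sub>R \<delta> n) / (\<delta> n)\<^sup>2))"
      \<comment> \<open>Majorant for Fubini: for fixed \<open>n\<close> the Gaussian factor is at
        most 1.\<close>
      have "integrable (lborel \<Otimes>\<^sub>M lborel) (\<lambda>z. complex_of_real (indicator ?B (fst z)) * (g (snd z) / (\<delta> n)\<^sup>2))"
        using intB g by (intro lborel_pair.integrable_pair_mult) auto
      then have "integrable (lborel \<Otimes>\<^sub>M lborel) (\<lambda>z. ?k (fst z) (snd z))"
      proof (rule Bochner_Integration.integrable_bound)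
        show "AE z in lborel \<Otimes>\<^sub>M lborel. norm (?k (fst z) (snd z)) \<le>
            norm (complex_of_real (indicator ?B (fst z)) * (g (snd z) / (\<delta> n)\<^sup>2))"
          using gauss2_le_1 gauss2_nonneg
          by (auto simp: indicator_def norm_mult norm_divide norm_power intro!: divide_right_mono mult_left_le)
      qed measurable
      then have "(\<integral>y. (\<integral>x. ?k x y \<partial>lborel) \<partial>lborel) = (\<integral>x. (\<integral>y. ?k x y \<partial>lborel) \<partial>lborel)"
        by (intro lborel_pair.Fubini_integral) (simp add: case_prod_unfold)
      moreover have "(\<integral>x. ?k x y \<partial>lborel) = g y * Q n y" for y
        unfolding Q_def integral_gauss2_rescaled[OF \<delta>, symmetric, OF borel_open[OF open_box]]
        by (simp only: integral_mult_right_zero integral_complex_of_real)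
      moreover have "(\<integral>y. ?k x y \<partial>lborel) =
          indicator ?B x *\<^sub>R (\<integral>y. g y * complex_of_real (gauss2 ((x - y) /\<^sub>R \<delta> n) / (\<delta> n)\<^sup>2) \<partial>lborel)" for x
        by (simp add: indicator_def)
      ultimately have "(\<integral>y. g y * Q n y \<partial>lborel) = (\<integral>x. indicator ?B x *\<^sub>R
          (\<integral>y. g y * complex_of_real (gauss2 ((x - y) /\<^sub>R \<delta> n) / (\<delta> n)\<^sup>2) \<partial>lborel) \<partial>lborel)"
        by (simp only:)
      then show ?thesis
        unfolding set_lebesgue_integral_def Hn_eq
        by (simp only: mult_scaleR_right[symmetric] integral_mult_right_zero)
    qed
    moreover have "(\<lambda>n. \<integral>y. g y * Q n y \<partial>lborel) \<longlonglongrightarrow> (\<integral>y. indicator ?B y *\<^sub>R g y \<partial>lborel)"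
    proof (rule integral_dominated_convergence[where w="\<lambda>y. norm (g y)"])
      \<comment> \<open>A box is convex, so the points where the averages may fail to converge to
        its indicator form a null set.\<close>
      have "frontier ?B \<in> null_sets lborel"
        using negligible_convex_frontier[OF convex_box(2)[of l r]]
        by (simp add: negligible_iff_null_sets null_sets_completion_iff)
      then have "AE y in lborel. y \<notin> frontier ?B"
        by (rule AE_not_in)
      then show "AE y in lborel. (\<lambda>n. g y * complex_of_real (Q n y)) \<longlonglongrightarrow> indicator ?B y *\<^sub>R g y"
      proof eventually_elim
        case (elim y)
        have "(\<lambda>n. Q n y) \<longlonglongrightarrow> indicator ?B y"
          unfolding Q_def \<delta>_def using elim by (intro gauss2_average_tendsto_indicator) auto
        then have "(\<lambda>n. g y * complex_of_real (Q n y)) \<longlonglongrightarrow> g y * complex_of_real (indicator ?B y)"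
          by (intro tendsto_intros)
        then show ?case by (simp add: scaleR_conv_of_real mult.commute)
      qed
      have "norm (Q n y) \<le> 1" for n y
        unfolding Q_def by (rule gauss2_average_bounds) auto
      then show "AE y in lborel. norm (g y * complex_of_real (Q n y)) \<le> norm (g y)" for n
        by (auto simp: norm_mult mult_left_le)
    qed (use g in \<open>auto simp: Q_def\<close>)
    ultimately have "(\<lambda>n. C * (\<integral>y. g y * Q n y \<partial>lborel)) \<longlonglongrightarrow> (LINT x:?B|lborel. H x)"
      and "(\<lambda>n. C * (\<integral>y. g y * Q n y \<partial>lborel)) \<longlonglongrightarrow> C * (LINT x:?B|lborel. g x)"
      by (auto simp: set_lebesgue_integral_def intro!: tendsto_mult_left)
    then show ?thesis by (rule LIMSEQ_unique)
  qed
  have gB: "set_integrable lborel (box l r) g" for l r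
    unfolding set_integrable_def using g by (intro integrable_mult_indicator) auto
  \<comment> \<open>So far \<open>H\<close> is only known to be bounded and measurable, which
    suffices on a box of finite measure.\<close>
  have HB: "set_integrable lborel (box l r) H" for l r
    unfolding set_integrable_def
  proof (rule Bochner_Integration.integrable_bound)
    show "integrable lborel (\<lambda>x. M * indicator (box l r) x)"
      by (intro integrable_mult_right integrable_real_indicator emeasure_lborel_box_finite) simp
  qed (use order_trans[OF H_bound abs_ge_self] in \<open>auto simp: indicator_def\<close>)
  have "AE x in lborel. H x - C * g x = 0"
  proof (rule AE_eq_0_if_box_integrals_eq_0)
    fix l r :: "real \<times> real"
    show "set_integrable lborel (box l r) (\<lambda>x. H x - C * g x)"
      using gB HB by (intro set_integral_diff) auto
    show "(LINT x:box l r|lborel. H x - C * g x) = 0"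
      using gB HB by (subst set_integral_diff) (auto simp: box_eq)
  qed
  then show ?thesis by (simp add: H_def C_def)
qed

text \<open>The pairing transfers the transform of \<open>f\<close> onto the reflected and shifted
  transform of \<open>g\<close>. Inversion evaluates the result almost everywhere, which is enough
  under the integral against \<open>f\<close>.\<close>

lemma fourier_convolution:
  fixes f g :: "real \<times> real \<Rightarrow> complex"
  assumes f: "integrable lborel f" and g: "integrable lborel g"
    and Fg: "integrable lborel (fourier b c g)" and nz: "b \<noteq> 0" "c \<noteq> 0"
  shows "(\<integral>t. fourier b c f t * fourier b c g (u - t) \<partial>lborel) =
    (2 * pi)\<^sup>2 * \<bar>b * c\<bar> * fourier b c (\<lambda>x. f x * g x) u"
proof -
  have [measurable]: "f \<in> borel_measurable borel" "g \<in> borel_measurable borel"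
    using f g by auto
  have reflect: "(\<integral>t. h (u - t) \<partial>lborel) = integral\<^sup>L lborel h"
    if [measurable]: "h \<in> borel_measurable borel" for h :: "real \<times> real \<Rightarrow> complex"
    using integral_distr[of "\<lambda>t. u - t" lborel borel h] by (simp add: lborel_distr_reflect)
  have reflected: "fourier b c (\<lambda>t. fourier b c g (u - t)) x =
      fourier b c (fourier b c g) (- x) * fourier_kernel b c x u" for x
  proof -
    \<comment> \<open>Writing \<open>t\<close> as \<open>u - (u - t)\<close> makes the whole
      integrand a function of \<open>u - t\<close>, so that \<open>reflect\<close> applies.\<close>
    have "fourier b c (\<lambda>t. fourier b c g (u - t)) x =
        (\<integral>t. fourier b c g (u - t) * fourier_kernel b c x (u - (u - t)) \<partial>lborel)"
      unfolding fourier_def[of b c "\<lambda>t. fourier b c g (u - t)"]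
      by (simp add: fourier_kernel_commute[of b c x])
    also have "\<dots> = (\<integral>s. fourier b c g s * fourier_kernel b c x (u - s) \<partial>lborel)"
      by (rule reflect) measurable
    also have "\<dots> = (\<integral>s. fourier b c g s * fourier_kernel b c s (- x) * fourier_kernel b c x u \<partial>lborel)"
      by (simp add: fourier_kernel_diff fourier_kernel_minus mult_ac fourier_kernel_commute[of b c _ x])
    finally show ?thesis by (simp add: fourier_def[of b c "fourier b c g"])
  qed
  have "integrable lborel (\<lambda>t. fourier b c g (u - t))"
    by (rule integrable_distr[of "\<lambda>t. u - t" lborel borel]) (use Fg in \<open>auto simp: lborel_distr_reflect\<close>)
  then have "(\<integral>t. fourier b c f t * fourier b c g (u - t) \<partial>lborel) =
      (\<integral>x. f x * fourier b c (\<lambda>t. fourier b c g (u - t)) x \<partial>lborel)"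
    using f by (intro fourier_pairing)
  also have "\<dots> = (\<integral>x. f x * (fourier b c (fourier b c g) (- x) * fourier_kernel b c x u) \<partial>lborel)"
    by (simp only: reflected)
  also have "(\<integral>x. f x * (fourier b c (fourier b c g) (- x) * fourier_kernel b c x u) \<partial>lborel) =
      (\<integral>x. (2 * pi)\<^sup>2 * \<bar>b * c\<bar> * (f x * g x * fourier_kernel b c x u) \<partial>lborel)"
  proof (rule integral_cong_AE)
    show "AE x in lborel. f x * (fourier b c (fourier b c g) (- x) * fourier_kernel b c x u) =
        (2 * pi)\<^sup>2 * \<bar>b * c\<bar> * (f x * g x * fourier_kernel b c x u)"
      using fourier_inversion[OF g Fg nz] by eventually_elim (simp add: mult_ac)
  qed measurable
  also have "\<dots> = (2 * pi)\<^sup>2 * \<bar>b * c\<bar> * fourier b c (\<lambda>x. f x * g x) u"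
    by (simp only: integral_mult_right_zero fourier_def)
  finally show ?thesis .
qed

subsection \<open>Transfer to quaternions\<close>

text \<open>Total and linear on all quaternions, but inverse to \<open>of_complex_mu\<close> only on
  \<open>H_mu\<close>; elsewhere it projects.\<close>

definition complex_of_mu :: "quat \<Rightarrow> complex" where
  "complex_of_mu q = Complex (q_re q) (q_mu q)"

lemma complex_of_mu_of_complex_mu [simp]: "complex_of_mu (of_complex_mu z) = z"
  by (simp add: complex_of_mu_def of_complex_mu_eq)

lemma of_complex_mu_complex_of_mu: "q \<in> H_mu \<Longrightarrow> of_complex_mu (complex_of_mu q) = q"
  by (auto simp: range_of_complex_mu[symmetric])

lemma norm_of_complex_mu [simp]: "norm (of_complex_mu z) = norm z"
  by (simp add: norm_quat_def inner_quat_def of_complex_mu_eq cmod_def power2_eq_square)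

lemma bounded_linear_of_complex_mu: "bounded_linear of_complex_mu"
  unfolding linear_conv_bounded_linear[symmetric]
  by (rule linearI) (simp_all add: of_complex_mu_eq quat_eq_iff plus_quat_def scaleR_quat_def)

lemma bounded_linear_complex_of_mu: "bounded_linear complex_of_mu"
  unfolding linear_conv_bounded_linear[symmetric]
  by (rule linearI) (simp_all add: complex_of_mu_def complex_eq_iff plus_quat_def scaleR_quat_def)

lemmas borel_measurable_of_complex_mu [measurable] =
    borel_measurable_continuous_onI[OF bounded_linear.continuous_on[OF bounded_linear_of_complex_mu continuous_on_id]]
  and borel_measurable_complex_of_mu [measurable] =
    borel_measurable_continuous_onI[OF bounded_linear.continuous_on[OF bounded_linear_complex_of_mu continuous_on_id]]

text \<open>The bounded linear left inverse makes integrability of the two integrands equivalent, so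
  the equation also covers the default value 0 of the integral.\<close>

lemma integral_of_complex_mu:
  "(\<integral>x. of_complex_mu (f x) \<partial>M) = of_complex_mu (integral\<^sup>L M f)"
  by (rule integral_bounded_linear'[OF bounded_linear_of_complex_mu bounded_linear_complex_of_mu]) simp

lemma of_complex_mu_power: "of_complex_mu (z ^ n) = of_complex_mu z ^ n"
  by (induction n) (simp_all add: of_complex_mu_hom)

text \<open>A bounded linear ring homomorphism passes through the exponential series term by
  term.\<close>

lemma of_complex_mu_exp: "of_complex_mu (exp z) = exp (of_complex_mu z)"
  unfolding exp_def bounded_linear.suminf[OF bounded_linear_of_complex_mu summable_exp_generic]
  by (simp add: of_complex_mu_power linear_cmul[OF bounded_linear.linear[OF bounded_linear_of_complex_mu]])

lemma of_complex_mu_of_real: "of_complex_mu (of_real r) = of_real r"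
  by (simp add: of_complex_mu_def)

lemma exp_mu: "exp (\<mu> * of_real t) = of_complex_mu (cis t)"
  by (simp add: cis_conv_exp of_complex_mu_exp of_complex_mu_hom of_complex_mu_of_real)

lemma of_complex_mu_inverse: "of_complex_mu (1 / z) = 1 / of_complex_mu z"
proof (cases "z = 0")
  case True
  then show ?thesis by (simp add: of_complex_mu_eq zero_quat_def[symmetric])
next
  case False
  then have "of_complex_mu (1 / z) * of_complex_mu z = 1"
    by (simp add: of_complex_mu_hom(1) flip: of_complex_mu_hom(4))
  then show ?thesis
    by (metis nonzero_eq_divide_eq mult_zero_right zero_neq_one)
qed

section \<open>The linear canonical transform over the complex numbers\<close>

text \<open>Complex counterpart of the normalising factor shared by \<open>K_mu\<close> and
  \<open>W_mu\<close>.\<close>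

definition lct_const :: "real \<Rightarrow> complex" where
  "lct_const b = 1 / csqrt (Complex 0 (2 * pi * b))"

lemma lct_const_nonzero: "b \<noteq> 0 \<Longrightarrow> lct_const b \<noteq> 0"
  by (simp add: lct_const_def Complex_eq_0)

text \<open>The principal roots of \<open>\<i> * r\<close> and \<open>- \<i> * r\<close> are
  conjugate for real \<open>r\<close>, so their product is \<open>\<bar>r\<bar>\<close>. The two
  signs come from a matrix and its inverse, whose upper right entries are opposite.\<close>

lemma lct_const_mult_minus: "lct_const b * lct_const (- b) = 1 / of_real (2 * pi * \<bar>b\<bar>)"
proof -
  have "csqrt (Complex 0 r) * csqrt (Complex 0 (- r)) = of_real \<bar>r\<bar>" for r
    by (simp add: complex_eq_iff cmod_def sgn_if)
  from this[of "2 * pi * b"] show ?thesis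
    by (simp add: lct_const_def abs_mult)
qed

lemma mu_const_eq: "1 / sqrt_mu (of_real (2 * pi * b) * \<mu>) = of_complex_mu (lct_const b)"
proof -
  have "of_real (2 * pi * b) * \<mu> = of_complex_mu (Complex 0 (2 * pi * b))"
    by (simp add: of_complex_mu_eq quat_eq_iff of_real_def scaleR_quat_def quat_ring_defs \<mu>_def)
  then show ?thesis
    by (simp add: sqrt_mu_of_complex_mu lct_const_def of_complex_mu_inverse)
qed

lemma K_mu_eq: "K_mu A x u = of_complex_mu (lct_const (A$1$2) *
    cis (A$1$1 / (2 * A$1$2) * x\<^sup>2 - 1 / A$1$2 * x * u + A$2$2 / (2 * A$1$2) * u\<^sup>2))"
  unfolding K_mu_def mu_const_eq exp_mu of_complex_mu_hom ..

lemma W_mu_eq: "W_mu A t \<tau> = of_complex_mu (lct_const (A$1$2) * cis (\<tau> * (\<tau> - t) * (A$1$1 / A$1$2)))"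
  unfolding W_mu_def mu_const_eq exp_mu of_complex_mu_hom ..

definition chirp :: "real \<Rightarrow> real \<Rightarrow> real \<times> real \<Rightarrow> complex" where
  "chirp p q z = cis (p * (fst z)\<^sup>2 + q * (snd z)\<^sup>2)"

lemma norm_chirp [simp]: "norm (chirp p q z) = 1"
  by (simp add: chirp_def)

lemma borel_measurable_chirp [measurable]: "chirp p q \<in> borel_measurable borel"
  unfolding chirp_def[abs_def] by (intro borel_measurable_continuous_onI continuous_intros)

text \<open>Complex form of \<open>lct_mu\<close>, already factored into constants, a chirp in the
  output variable and the Fourier transform of the chirped input.\<close>

definition lct_complex :: "real^2^2 \<Rightarrow> real^2^2 \<Rightarrow> (real \<times> real \<Rightarrow> complex) \<Rightarrow> real \<times> real \<Rightarrow> complex" where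
  "lct_complex A B \<phi> s = lct_const (A$1$2) * lct_const (B$1$2) *
     chirp (A$2$2 / (2 * A$1$2)) (B$2$2 / (2 * B$1$2)) s *
     fourier (A$1$2) (B$1$2) (\<lambda>z. \<phi> z * chirp (A$1$1 / (2 * A$1$2)) (B$1$1 / (2 * B$1$2)) z) s"

lemma borel_measurable_lct_complex [measurable]:
  "\<phi> \<in> borel_measurable borel \<Longrightarrow> lct_complex A B \<phi> \<in> borel_measurable borel"
  unfolding lct_complex_def[abs_def]
  by (intro borel_measurable_times borel_measurable_const borel_measurable_chirp borel_measurable_fourier)

text \<open>In the commutative \<open>H_mu\<close> the left and right kernels merge into one complex
  factor. The integral ignores null sets, so \<open>f\<close> may be replaced by a Borel function
  and the completed measure by \<open>lborel\<close>.\<close>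

lemma lct_mu_eq:
  assumes f: "f \<in> borel_measurable lebesgue" and [measurable]: "\<phi> \<in> borel_measurable borel"
    and f\<phi>: "AE z in lebesgue. f z = of_complex_mu (\<phi> z)"
  shows "lct_mu A B f s = of_complex_mu (lct_complex A B \<phi> s)"
proof -
  let ?K1 = "\<lambda>z. lct_const (A$1$2) *
    cis (A$1$1 / (2 * A$1$2) * (fst z)\<^sup>2 - 1 / A$1$2 * fst z * fst s + A$2$2 / (2 * A$1$2) * (fst s)\<^sup>2)"
  let ?K2 = "\<lambda>z. lct_const (B$1$2) *
    cis (B$1$1 / (2 * B$1$2) * (snd z)\<^sup>2 - 1 / B$1$2 * snd z * snd s + B$2$2 / (2 * B$1$2) * (snd s)\<^sup>2)"
  have K[measurable]: "?K1 \<in> borel_measurable borel" "?K2 \<in> borel_measurable borel"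
    by (intro borel_measurable_continuous_onI continuous_intros)+
  have Kmeas: "(\<lambda>z. ?K1 z * \<phi> z * ?K2 z) \<in> borel_measurable lborel"
    unfolding measurable_lborel2 by (intro borel_measurable_times K assms(2))
  have K'[measurable]: "(\<lambda>z. of_complex_mu (?K1 z)) \<in> borel_measurable lebesgue"
     "(\<lambda>z. of_complex_mu (?K2 z)) \<in> borel_measurable lebesgue"
     "(\<lambda>z. of_complex_mu (?K1 z * \<phi> z * ?K2 z)) \<in> borel_measurable lebesgue"
    using K Kmeas
    by (auto intro!: measurable_completion measurable_compose[OF _ borel_measurable_of_complex_mu]
      simp del: times_divide_eq_left)
  have "lct_mu A B f s = (\<integral>z. of_complex_mu (?K1 z) * f z * of_complex_mu (?K2 z) \<partial>lebesgue)"
    by (simp only: lct_mu_def case_prod_unfold K_mu_eq prod.collapse)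
  also have "\<dots> = (\<integral>z. of_complex_mu (?K1 z * \<phi> z * ?K2 z) \<partial>lebesgue)"
  proof (rule integral_cong_AE)
    show "(\<lambda>z. of_complex_mu (?K1 z) * f z * of_complex_mu (?K2 z)) \<in> borel_measurable lebesgue"
      using f K' by (intro borel_measurable_times)
    show "AE z in lebesgue. of_complex_mu (?K1 z) * f z * of_complex_mu (?K2 z) =
        of_complex_mu (?K1 z * \<phi> z * ?K2 z)"
      using f\<phi> by eventually_elim (simp only: of_complex_mu_hom(4))
  qed (rule K')
  also have "\<dots> = of_complex_mu (\<integral>z. ?K1 z * \<phi> z * ?K2 z \<partial>lborel)"
    by (simp only: integral_of_complex_mu integral_completion[OF Kmeas])
  also have "(\<integral>z. ?K1 z * \<phi> z * ?K2 z \<partial>lborel) =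
    (\<integral>z. lct_const (A$1$2) * lct_const (B$1$2) *
       chirp (A$2$2 / (2 * A$1$2)) (B$2$2 / (2 * B$1$2)) s *
       (\<phi> z * chirp (A$1$1 / (2 * A$1$2)) (B$1$1 / (2 * B$1$2)) z *
        fourier_kernel (A$1$2) (B$1$2) z s) \<partial>lborel)"
  proof (intro Bochner_Integration.integral_cong refl)
    fix z
    have "cis (A$1$1 / (2 * A$1$2) * (fst z)\<^sup>2 - 1 / A$1$2 * fst z * fst s + A$2$2 / (2 * A$1$2) * (fst s)\<^sup>2) *
        cis (B$1$1 / (2 * B$1$2) * (snd z)\<^sup>2 - 1 / B$1$2 * snd z * snd s + B$2$2 / (2 * B$1$2) * (snd s)\<^sup>2) =
      chirp (A$2$2 / (2 * A$1$2)) (B$2$2 / (2 * B$1$2)) s *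
      chirp (A$1$1 / (2 * A$1$2)) (B$1$1 / (2 * B$1$2)) z * fourier_kernel (A$1$2) (B$1$2) z s"
      unfolding chirp_def fourier_kernel_def cis_mult
      by (rule arg_cong[of _ _ cis]) (simp add: algebra_simps)
    then show "?K1 z * \<phi> z * ?K2 z = lct_const (A$1$2) * lct_const (B$1$2) *
       chirp (A$2$2 / (2 * A$1$2)) (B$2$2 / (2 * B$1$2)) s *
       (\<phi> z * chirp (A$1$1 / (2 * A$1$2)) (B$1$1 / (2 * B$1$2)) z *
        fourier_kernel (A$1$2) (B$1$2) z s)"
      by algebra
  qed
  also have "\<dots> = lct_complex A B \<phi> s"
    unfolding lct_complex_def fourier_def by (rule integral_mult_right_zero)
  finally show ?thesis .
qed

text \<open>After all chirps and constants are collected, the weighted convolution is an ordinary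
  convolution of the Fourier transforms \<open>F\<close> and \<open>G\<close>, to which
  \<open>fourier_convolution\<close> applies.\<close>

lemma conv_mu_inverse_eq:
  assumes det: "det A = 1" "det B = 1" and nz: "A$1$2 \<noteq> 0" "B$1$2 \<noteq> 0"
    and [measurable]: "\<phi> \<in> borel_measurable borel" "\<gamma> \<in> borel_measurable borel"
    and int: "integrable lborel \<phi>" "integrable lborel \<gamma>" "integrable lborel (lct_complex A B \<gamma>)"
  shows "conv_mu (matrix_inv A) (matrix_inv B)
      (\<lambda>s. of_complex_mu (lct_complex A B \<phi> s)) (\<lambda>s. of_complex_mu (lct_complex A B \<gamma> s)) s =
    of_complex_mu (lct_complex A B
      (\<lambda>z. chirp (A$1$1 / (2 * A$1$2)) (B$1$1 / (2 * B$1$2)) z * \<phi> z * \<gamma> z) s)"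
proof -
  define b1 b2 where "b1 = A$1$2" and "b2 = B$1$2"
  define ch where "ch = chirp (A$1$1 / (2 * A$1$2)) (B$1$1 / (2 * B$1$2))"
  define dh where "dh = chirp (A$2$2 / (2 * A$1$2)) (B$2$2 / (2 * B$1$2))"
  define F where "F = fourier b1 b2 (\<lambda>z. \<phi> z * ch z)"
  define G where "G = fourier b1 b2 (\<lambda>z. \<gamma> z * ch z)"
  define k where "k = lct_const b1 * lct_const b2"
  define k' where "k' = lct_const (- b1) * lct_const (- b2)"
  have [measurable]: "ch \<in> borel_measurable borel" "dh \<in> borel_measurable borel"
    unfolding ch_def dh_def by measurable
  have [measurable]: "F \<in> borel_measurable borel" "G \<in> borel_measurable borel"
    unfolding F_def G_def by measurable
  have inv: "matrix_inv A $1$2 = - b1" "matrix_inv A $1$1 = A$2$2"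
     "matrix_inv B $1$2 = - b2" "matrix_inv B $1$1 = B$2$2"
    using det by (simp_all add: matrix_inv_det_1 mat2_def b1_def b2_def)
  have lct: "lct_complex A B \<phi> t = k * dh t * F t" "lct_complex A B \<gamma> t = k * dh t * G t" for t
    by (simp_all add: lct_complex_def k_def dh_def F_def G_def ch_def b1_def b2_def)
  have k0: "k \<noteq> 0"
    using nz lct_const_nonzero by (simp add: k_def b1_def b2_def)
  \<comment> \<open>The weights contribute \<open>k'\<close> and the two transforms
    \<open>k * k\<close>. One \<open>k\<close> cancels with \<open>k'\<close> against the constant
    of the convolution theorem; the other remains as normalisation of the result.\<close>
  have kk': "k' * k * ((2 * pi)\<^sup>2 * \<bar>b1 * b2\<bar>) = 1"
  proof -
    have "k' * k = (lct_const b1 * lct_const (- b1)) * (lct_const b2 * lct_const (- b2))"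
      by (simp add: k_def k'_def mult_ac)
    then show ?thesis
      using nz by (simp add: lct_const_mult_minus b1_def b2_def abs_mult power2_eq_square)
  qed
  have norm_dh: "norm (dh t) = 1" for t by (simp add: dh_def)
  \<comment> \<open>\<open>G\<close> differs from the integrable transform only by the nonzero
    constant \<open>k\<close> and a factor of modulus 1.\<close>
  have intG: "integrable lborel G"
  proof -
    have "integrable lborel (\<lambda>t. norm (lct_complex A B \<gamma> t) / norm k)"
      using int(3) by (intro integrable_divide integrable_norm) auto
    then have "integrable lborel (\<lambda>t. norm (G t))"
      using k0 by (simp add: lct norm_mult norm_dh)
    then show ?thesis by (subst (asm) integrable_norm_iff) auto
  qed
  have chirped: "integrable lborel (\<lambda>z. h z * ch z)" if "integrable lborel h" for h
    by (rule Bochner_Integration.integrable_bound[OF that]) (use that in \<open>auto simp: norm_mult ch_def\<close>)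
  let ?w1 = "\<lambda>t. cis (fst t * (fst t - fst s) * (A$2$2 / - b1))"
  let ?w2 = "\<lambda>t. cis (snd t * (snd t - snd s) * (B$2$2 / - b2))"
  have w: "?w1 \<in> borel_measurable borel" "?w2 \<in> borel_measurable borel"
    unfolding divide_inverse by (intro borel_measurable_continuous_onI continuous_intros)+
  have lct_meas: "lct_complex A B \<phi> \<in> borel_measurable borel" "(\<lambda>t. lct_complex A B \<gamma> (s - t)) \<in> borel_measurable borel"
    by measurable
  have conv_meas: "(\<lambda>t. lct_const (- b1) * ?w1 t * lct_complex A B \<phi> t * lct_complex A B \<gamma> (s - t) *
       (lct_const (- b2) * ?w2 t)) \<in> borel_measurable lborel"
    unfolding measurable_lborel2 by (intro borel_measurable_times borel_measurable_const w lct_meas)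
  have "conv_mu (matrix_inv A) (matrix_inv B)
      (\<lambda>s. of_complex_mu (lct_complex A B \<phi> s)) (\<lambda>s. of_complex_mu (lct_complex A B \<gamma> s)) s =
    (\<integral>t. of_complex_mu (lct_const (- b1) * ?w1 t * lct_complex A B \<phi> t * lct_complex A B \<gamma> (s - t) *
       (lct_const (- b2) * ?w2 t)) \<partial>lebesgue)"
    by (simp only: conv_mu_def case_prod_unfold W_mu_eq inv of_complex_mu_hom(4) prod.collapse minus_prod_def)
  also have "\<dots> = of_complex_mu (\<integral>t. lct_const (- b1) * ?w1 t * lct_complex A B \<phi> t * lct_complex A B \<gamma> (s - t) *
       (lct_const (- b2) * ?w2 t) \<partial>lborel)"
    by (simp only: integral_of_complex_mu integral_completion[OF conv_meas])
  also have "(\<integral>t. lct_const (- b1) * ?w1 t * lct_complex A B \<phi> t * lct_complex A B \<gamma> (s - t) *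
       (lct_const (- b2) * ?w2 t) \<partial>lborel) = (\<integral>t. k' * k * k * dh s * (F t * G (s - t)) \<partial>lborel)"
  proof (intro Bochner_Integration.integral_cong refl)
    fix t
    \<comment> \<open>In each coordinate this is the identity
      \<open>t^2 + (s - t)^2 - 2 * t * (t - s) = s^2\<close> for the exponents, so the dependence on
      \<open>t\<close> disappears.\<close>
    have "dh s = ?w1 t * ?w2 t * dh t * dh (s - t)"
      unfolding dh_def chirp_def cis_mult
      using nz by (intro arg_cong[of _ _ cis]) (simp add: b1_def b2_def field_simps power2_eq_square)
    then show "lct_const (- b1) * ?w1 t * lct_complex A B \<phi> t * lct_complex A B \<gamma> (s - t) *
       (lct_const (- b2) * ?w2 t) = k' * k * k * dh s * (F t * G (s - t))"
      unfolding lct k'_def by (simp only: mult_ac)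
  qed
  also have "\<dots> = k' * k * k * dh s * (\<integral>t. F t * G (s - t) \<partial>lborel)"
    by (rule integral_mult_right_zero)
  also have "(\<integral>t. F t * G (s - t) \<partial>lborel) =
      (2 * pi)\<^sup>2 * \<bar>b1 * b2\<bar> * fourier b1 b2 (\<lambda>z. (\<phi> z * ch z) * (\<gamma> z * ch z)) s"
    unfolding F_def G_def
    using nz int chirped intG by (intro fourier_convolution) (auto simp: b1_def b2_def G_def)
  also have "k' * k * k * dh s *
      ((2 * pi)\<^sup>2 * \<bar>b1 * b2\<bar> * fourier b1 b2 (\<lambda>z. (\<phi> z * ch z) * (\<gamma> z * ch z)) s) =
      k * dh s * fourier b1 b2 (\<lambda>z. (\<phi> z * ch z) * (\<gamma> z * ch z)) s"
    using kk' by algebra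
  \<comment> \<open>Of the two factors \<open>ch\<close>, one is the input chirp built into
    \<open>lct_complex\<close>; the other stays in its argument.\<close>
  also have "\<dots> = lct_complex A B (\<lambda>z. ch z * \<phi> z * \<gamma> z) s"
    by (simp add: lct_complex_def k_def dh_def ch_def b1_def b2_def mult_ac)
  finally show ?thesis by (simp only: ch_def)
qed

text \<open>\<open>breve\<close> keeps the right column and doubles the upper left entry, so
  constants, kernel and output chirp agree and the input chirp is squared. This reduces both claims
  of the theorem to the same transform.\<close>

lemma lct_complex_breve:
  assumes "A$1$2 \<noteq> 0" "B$1$2 \<noteq> 0"
  shows "lct_complex (breve A) (breve B) \<phi> =
    lct_complex A B (\<lambda>z. chirp (A$1$1 / (2 * A$1$2)) (B$1$1 / (2 * B$1$2)) z * \<phi> z)"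
proof -
  have "chirp (A$1$1 / (2 * A$1$2)) (B$1$1 / (2 * B$1$2)) z *
      chirp (A$1$1 / (2 * A$1$2)) (B$1$1 / (2 * B$1$2)) z =
      chirp (2 * A$1$1 / (2 * A$1$2)) (2 * B$1$1 / (2 * B$1$2)) z" for z
    unfolding chirp_def cis_mult by (intro arg_cong[of _ _ cis]) (use assms in \<open>simp add: field_simps\<close>)
  then show ?thesis
    by (simp add: fun_eq_iff lct_complex_def breve_def mat2_def mult_ac)
qed

section \<open>Borel representatives and the conclusion for quaternions\<close>

text \<open>Members of \<open>Lp_mu\<close> are measurable only for the completed measure, while the
  Fubini arguments use \<open>lborel\<close>. Each real coordinate is therefore changed on a null
  set to a Borel function.\<close>

lemma Lp_mu_1_borel_representative:
  assumes "f \<in> Lp_mu 1"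
  obtains \<phi> where "\<phi> \<in> borel_measurable borel" "integrable lborel \<phi>"
    "AE z in lebesgue. f z = of_complex_mu (\<phi> z)"
proof -
  have H: "f z \<in> H_mu" for z
    using assms by (auto simp: Lp_mu_def)
  have f[measurable]: "f \<in> borel_measurable lebesgue" and int: "integrable lebesgue (\<lambda>z. norm (f z))"
    using assms by (auto simp: Lp_mu_def)
  have re: "(\<lambda>z. Re (complex_of_mu (f z))) \<in> borel_measurable lebesgue"
    and im: "(\<lambda>z. Im (complex_of_mu (f z))) \<in> borel_measurable lebesgue"
    by measurable
  obtain r i where ri: "r \<in> borel_measurable lborel" "i \<in> borel_measurable lborel"
    "AE z in lborel. Re (complex_of_mu (f z)) = r z" "AE z in lborel. Im (complex_of_mu (f z)) = i z"
    using completion_ex_borel_measurable_real[OF re] completion_ex_borel_measurable_real[OF im] by blast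
  define \<phi> where "\<phi> z = Complex (r z) (i z)" for z
  have \<phi>[measurable]: "\<phi> \<in> borel_measurable borel"
    using ri by (simp add: borel_measurable_complex_iff \<phi>_def)
  have "AE z in lborel. f z = of_complex_mu (\<phi> z)"
    using ri(3,4)
  proof eventually_elim
    case (elim z)
    then have "\<phi> z = complex_of_mu (f z)"
      by (simp add: \<phi>_def complex_eq_iff)
    then show ?case using H by (simp add: of_complex_mu_complex_of_mu)
  qed
  then have ae: "AE z in lebesgue. f z = of_complex_mu (\<phi> z)"
    by (rule AE_completion)
  have "integrable lebesgue \<phi>"
    using int
  proof (rule Bochner_Integration.integrable_bound)
    show "\<phi> \<in> borel_measurable lebesgue"
      by (intro measurable_completion) simp
    show "AE z in lebesgue. norm (\<phi> z) \<le> norm (norm (f z))"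
      using ae by eventually_elim simp
  qed
  then have "integrable lborel \<phi>"
    by (simp add: integrable_completion)
  with \<phi> ae show ?thesis by (intro that)
qed

theorem corollary2:
  fixes A1 A2 :: "real^2^2" and p :: nat and f g :: "real \<times> real \<Rightarrow> quat"
  assumes "det A1 = 1" and "A1$1$2 \<noteq> 0"
    and "det A2 = 1" and "A2$1$2 \<noteq> 0"
    and "p \<ge> 1"
    and "f \<in> Lp_mu 1 \<inter> Lp_mu 2" and "g \<in> Lp_mu 1 \<inter> Lp_mu 2"
    and "lct_mu A1 A2 f \<in> Lp_mu p" and "lct_mu A1 A2 g \<in> Lp_mu 1"
  shows "(\<forall>u v.
      lct_mu A1 A2
        (\<lambda>(x, y). exp (\<mu> * of_real (A1$1$1 / (2 * A1$1$2) * x\<^sup>2)) *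
                   exp (\<mu> * of_real (A2$1$1 / (2 * A2$1$2) * y\<^sup>2)) * f (x, y) * g (x, y)) (u, v)
      = conv_mu (matrix_inv A1) (matrix_inv A2) (lct_mu A1 A2 f) (lct_mu A1 A2 g) (u, v)) \<and>
    (\<forall>u v.
      lct_mu (breve A1) (breve A2) (\<lambda>(x, y). f (x, y) * g (x, y)) (u, v)
      = conv_mu (matrix_inv A1) (matrix_inv A2) (lct_mu A1 A2 f) (lct_mu A1 A2 g) (u, v))"
proof -
  define ch where "ch = chirp (A1$1$1 / (2 * A1$1$2)) (A2$1$1 / (2 * A2$1$2))"
  have f: "f \<in> borel_measurable lebesgue" and g: "g \<in> borel_measurable lebesgue"
    using assms by (auto simp: Lp_mu_def)
  obtain \<phi> where \<phi>[measurable]: "\<phi> \<in> borel_measurable borel" and \<phi>_int: "integrable lborel \<phi>"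
    and f\<phi>: "AE z in lebesgue. f z = of_complex_mu (\<phi> z)"
    using Lp_mu_1_borel_representative[of f] assms by auto
  obtain \<gamma> where \<gamma>[measurable]: "\<gamma> \<in> borel_measurable borel" and \<gamma>_int: "integrable lborel \<gamma>"
    and g\<gamma>: "AE z in lebesgue. g z = of_complex_mu (\<gamma> z)"
    using Lp_mu_1_borel_representative[of g] assms by auto
  have [measurable]: "ch \<in> borel_measurable borel"
    by (simp add: ch_def)
  \<comment> \<open>These hold at every point, since null sets matter only under the integral; hence
    they can be substituted inside \<open>conv_mu\<close>.\<close>
  have lct: "lct_mu A1 A2 f = (\<lambda>s. of_complex_mu (lct_complex A1 A2 \<phi> s))"
      "lct_mu A1 A2 g = (\<lambda>s. of_complex_mu (lct_complex A1 A2 \<gamma> s))"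
    using lct_mu_eq[OF f \<phi> f\<phi>] lct_mu_eq[OF g \<gamma> g\<gamma>] by (auto simp: fun_eq_iff)
  \<comment> \<open>The hypothesis on the transform of \<open>g\<close> supplies the integrability
    that Fourier inversion requires.\<close>
  have "integrable lebesgue (\<lambda>s. norm (lct_complex A1 A2 \<gamma> s))"
    using assms(9) by (simp add: Lp_mu_def lct)
  then have "integrable lborel (lct_complex A1 A2 \<gamma>)"
    by (simp add: integrable_completion integrable_norm_iff)
  then have conv: "conv_mu (matrix_inv A1) (matrix_inv A2) (lct_mu A1 A2 f) (lct_mu A1 A2 g) s =
      of_complex_mu (lct_complex A1 A2 (\<lambda>z. ch z * \<phi> z * \<gamma> z) s)" for s
    unfolding lct ch_def using assms \<phi>_int \<gamma>_int by (intro conv_mu_inverse_eq) auto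
  have exp_ch: "exp (\<mu> * of_real (A1$1$1 / (2 * A1$1$2) * (fst z)\<^sup>2)) *
      exp (\<mu> * of_real (A2$1$1 / (2 * A2$1$2) * (snd z)\<^sup>2)) = of_complex_mu (ch z)" for z
    unfolding exp_mu of_complex_mu_hom(4)[symmetric] cis_mult ch_def chirp_def ..
  have ch_leb: "(\<lambda>z. of_complex_mu (ch z)) \<in> borel_measurable lebesgue"
    by (intro measurable_completion) measurable
  have "lct_mu A1 A2 (\<lambda>(x, y). exp (\<mu> * of_real (A1$1$1 / (2 * A1$1$2) * x\<^sup>2)) *
      exp (\<mu> * of_real (A2$1$1 / (2 * A2$1$2) * y\<^sup>2)) * f (x, y) * g (x, y)) s =
      of_complex_mu (lct_complex A1 A2 (\<lambda>z. ch z * \<phi> z * \<gamma> z) s)" for s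
    unfolding case_prod_unfold prod.collapse exp_ch
  proof (rule lct_mu_eq)
    show "(\<lambda>z. of_complex_mu (ch z) * f z * g z) \<in> borel_measurable lebesgue"
      using ch_leb f g by (intro borel_measurable_times)
    show "AE z in lebesgue. of_complex_mu (ch z) * f z * g z = of_complex_mu (ch z * \<phi> z * \<gamma> z)"
      using f\<phi> g\<gamma> by eventually_elim (simp only: of_complex_mu_hom(4))
  qed measurable
  moreover have "lct_mu (breve A1) (breve A2) (\<lambda>(x, y). f (x, y) * g (x, y)) s =
      of_complex_mu (lct_complex (breve A1) (breve A2) (\<lambda>z. \<phi> z * \<gamma> z) s)" for s
    unfolding case_prod_unfold prod.collapse
  proof (rule lct_mu_eq)
    show "(\<lambda>z. f z * g z) \<in> borel_measurable lebesgue"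
      using f g by (intro borel_measurable_times)
    show "AE z in lebesgue. f z * g z = of_complex_mu (\<phi> z * \<gamma> z)"
      using f\<phi> g\<gamma> by eventually_elim (simp only: of_complex_mu_hom(4))
  qed measurable
  ultimately show ?thesis
    using assms by (simp add: conv lct_complex_breve ch_def mult.assoc)
qed

end
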